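(* Let $X$ be a set and let $f$ be a homogeneous element of degree $n$ in $Zin(X)$. Then $f$ is a Jordan element if and only if $D(f)=n!\,f$. Moreover, the algebra $J(X)$ (with product $\{\,,\}$) is isomorphic to the algebra of polynomials without constant term in the commuting variables $X$ over $\mathbf{K}$.
   Context: All algebras are over a field $\mathbf{K}$ of characteristic $0$. A (right-)Zinbiel algebra is a (non-unital, non-associative) algebra with product $\circ$ satisfying $a\circ(b\circ c)=(a\circ b+b\circ a)\circ c$. $Zin(X)$ is the free Zinbiel algebra on the set $X$; $a_1a_2\cdots a_n$ denotes the left-bracketed product $(\cdots(a_1\circ a_2)\circ\cdots)\circ a_n$. It is known (Loday) that the left-bracketed words $x_{i_1}\cdots x_{i_n}$ ($n\ge1$) in elements of $X$ form a linear basis of $Zin(X)$. Put $\{a,b\}=a\circ b+b\circ a$. $J(X)$ is the subalgebra of $Zin(X)^{(+)}=(Zin(X),\{\,,\})$ generated by $X$; an element of $Zin(X)$ is a Jordan element if it can be expressed through elements of $X$ using $\{\,,\}$ (and linear combinations), i.e. if it lies in $J(X)$. The Dynkin map $D:Zin(X)\to Zin(X)$ is the linear map given on basis words by $D(x_{i_1}x_{i_2}\cdots x_{i_n})=\{\{\cdots\{x_{i_1},x_{i_2}\},\cdots\},x_{i_n}\}$ (left-bracketed; $D(x)=x$ for $x\in X$). *)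

theory Defs
  imports Complex_Main "HOL-Library.Poly_Mapping" "HOL-Library.Function_Algebras"
begin

section \<open>Non-associative algebras\<close>

locale nonassoc_algebra = vector_space scale
  for scale :: "'k::field \<Rightarrow> 'a::ab_group_add \<Rightarrow> 'a" +
  fixes mul :: "'a \<Rightarrow> 'a \<Rightarrow> 'a"
  assumes mul_add_left: "mul (a + b) c = mul a c + mul b c"
    and mul_add_right: "mul a (b + c) = mul a b + mul a c"
    and mul_scale_left: "mul (scale r a) b = scale r (mul a b)"
    and mul_scale_right: "mul a (scale r b) = scale r (mul a b)"

locale zinbiel_algebra = nonassoc_algebra scale mul
  for scale :: "'k::field \<Rightarrow> 'a::ab_group_add \<Rightarrow> 'a" and mul :: "'a \<Rightarrow> 'a \<Rightarrow> 'a" +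
  assumes zinbiel: "mul a (mul b c) = mul (mul a b + mul b a) c"

inductive_set subalgebra_generated ::
  "('k \<Rightarrow> 'a::ab_group_add \<Rightarrow> 'a) \<Rightarrow> ('a \<Rightarrow> 'a \<Rightarrow> 'a) \<Rightarrow> 'a set \<Rightarrow> 'a set"
  for scale :: "'k \<Rightarrow> 'a::ab_group_add \<Rightarrow> 'a" and mul :: "'a \<Rightarrow> 'a \<Rightarrow> 'a" and S :: "'a set"
where
  sg_zero: "0 \<in> subalgebra_generated scale mul S"
| sg_gen: "s \<in> S \<Longrightarrow> s \<in> subalgebra_generated scale mul S"
| sg_add: "a \<in> subalgebra_generated scale mul S \<Longrightarrow> b \<in> subalgebra_generated scale mul S
    \<Longrightarrow> a + b \<in> subalgebra_generated scale mul S"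
| sg_scale: "a \<in> subalgebra_generated scale mul S \<Longrightarrow> scale r a \<in> subalgebra_generated scale mul S"
| sg_prod: "a \<in> subalgebra_generated scale mul S \<Longrightarrow> b \<in> subalgebra_generated scale mul S
    \<Longrightarrow> mul a b \<in> subalgebra_generated scale mul S"

definition algebra_hom_on ::
  "'a set \<Rightarrow> ('k \<Rightarrow> 'a::ab_group_add \<Rightarrow> 'a) \<Rightarrow> ('a \<Rightarrow> 'a \<Rightarrow> 'a) \<Rightarrow>
   ('k \<Rightarrow> 'b::ab_group_add \<Rightarrow> 'b) \<Rightarrow> ('b \<Rightarrow> 'b \<Rightarrow> 'b) \<Rightarrow> ('a \<Rightarrow> 'b) \<Rightarrow> bool"
where
  "algebra_hom_on A scale1 mul1 scale2 mul2 \<phi> \<longleftrightarrow>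
     (\<forall>a\<in>A. \<forall>b\<in>A. \<phi> (a + b) = \<phi> a + \<phi> b) \<and>
     (\<forall>r. \<forall>a\<in>A. \<phi> (scale1 r a) = scale2 r (\<phi> a)) \<and>
     (\<forall>a\<in>A. \<forall>b\<in>A. \<phi> (mul1 a b) = mul2 (\<phi> a) (\<phi> b))"

definition algebras_isomorphic ::
  "'a set \<Rightarrow> ('k \<Rightarrow> 'a::ab_group_add \<Rightarrow> 'a) \<Rightarrow> ('a \<Rightarrow> 'a \<Rightarrow> 'a) \<Rightarrow>
   'b set \<Rightarrow> ('k \<Rightarrow> 'b::ab_group_add \<Rightarrow> 'b) \<Rightarrow> ('b \<Rightarrow> 'b \<Rightarrow> 'b) \<Rightarrow> bool"
where
  "algebras_isomorphic A scale1 mul1 B scale2 mul2 \<longleftrightarrow>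
     (\<exists>\<phi>. bij_betw \<phi> A B \<and> algebra_hom_on A scale1 mul1 scale2 mul2 \<phi>)"

section \<open>The free Zinbiel algebra\<close>

text \<open>Formal algebra expressions in the letters 'x with scalars 'k, modulo the congruence generated
  by the vector space axioms, bilinearity of the product and the Zinbiel identity.\<close>

datatype ('x, 'k) zterm =
    Gen 'x
  | Zero
  | Add "('x, 'k) zterm" "('x, 'k) zterm"
  | Scale 'k "('x, 'k) zterm"
  | Prod "('x, 'k) zterm" "('x, 'k) zterm"

inductive zeq :: "('x, 'k::field) zterm \<Rightarrow> ('x, 'k) zterm \<Rightarrow> bool" (infix \<open>\<approx>\<close> 50) where
  refl: "a \<approx> a"
| sym: "a \<approx> b \<Longrightarrow> b \<approx> a"
| trans: "a \<approx> b \<Longrightarrow> b \<approx> c \<Longrightarrow> a \<approx> c"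
| cong_add: "a \<approx> a' \<Longrightarrow> b \<approx> b' \<Longrightarrow> Add a b \<approx> Add a' b'"
| cong_scale: "a \<approx> a' \<Longrightarrow> Scale r a \<approx> Scale r a'"
| cong_prod: "a \<approx> a' \<Longrightarrow> b \<approx> b' \<Longrightarrow> Prod a b \<approx> Prod a' b'"
| add_assoc: "Add (Add a b) c \<approx> Add a (Add b c)"
| add_comm: "Add a b \<approx> Add b a"
| add_zero: "Add Zero a \<approx> a"
| add_inv: "Add (Scale (-1) a) a \<approx> Zero"
| scale_add: "Scale r (Add a b) \<approx> Add (Scale r a) (Scale r b)"
| add_scale: "Scale (r + s) a \<approx> Add (Scale r a) (Scale s a)"
| scale_scale: "Scale r (Scale s a) \<approx> Scale (r * s) a"
| scale_one: "Scale 1 a \<approx> a"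
| mul_add_left: "Prod (Add a b) c \<approx> Add (Prod a c) (Prod b c)"
| mul_add_right: "Prod a (Add b c) \<approx> Add (Prod a b) (Prod a c)"
| mul_scale_left: "Prod (Scale r a) b \<approx> Scale r (Prod a b)"
| mul_scale_right: "Prod a (Scale r b) \<approx> Scale r (Prod a b)"
| zinbiel: "Prod a (Prod b c) \<approx> Prod (Add (Prod a b) (Prod b a)) c"

quotient_type (overloaded) ('x, 'k) zin = "('x, 'k::field) zterm" / zeq
  by (intro equivpI reflpI sympI transpI) (blast intro: zeq.refl zeq.sym zeq.trans)+

instantiation zin :: (type, field) ab_group_add
begin

lift_definition zero_zin :: "('a, 'b) zin" is Zero .
lift_definition plus_zin :: "('a, 'b) zin \<Rightarrow> ('a, 'b) zin \<Rightarrow> ('a, 'b) zin" is Add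
  by (rule zeq.cong_add)
lift_definition uminus_zin :: "('a, 'b) zin \<Rightarrow> ('a, 'b) zin" is "Scale (-1)"
  by (rule zeq.cong_scale)
definition minus_zin :: "('a, 'b) zin \<Rightarrow> ('a, 'b) zin \<Rightarrow> ('a, 'b) zin" where
  "minus_zin a b = a + - b"

instance
proof
  fix a b c :: "('a, 'b) zin"
  show "a + b + c = a + (b + c)" by transfer (rule zeq.add_assoc)
  show "a + b = b + a" by transfer (rule zeq.add_comm)
  show "0 + a = a" by transfer (rule zeq.add_zero)
  show "- a + a = 0" by transfer (rule zeq.add_inv)
  show "a - b = a + - b" by (rule minus_zin_def)
qed

end

lift_definition zgen :: "'x \<Rightarrow> ('x, 'k::field) zin" is Gen .
lift_definition zscale :: "'k \<Rightarrow> ('x, 'k::field) zin \<Rightarrow> ('x, 'k) zin" is Scale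
  by (rule zeq.cong_scale)
lift_definition zprod :: "('x, 'k::field) zin \<Rightarrow> ('x, 'k) zin \<Rightarrow> ('x, 'k) zin" (infixl \<open>\<circ>\<^sub>z\<close> 70) is Prod
  by (rule zeq.cong_prod)

interpretation zin: zinbiel_algebra zscale zprod
proof
  fix a b c :: "('x, 'k::field) zin" and r s :: 'k
  show "zscale r (a + b) = zscale r a + zscale r b" by transfer (rule zeq.scale_add)
  show "zscale (r + s) a = zscale r a + zscale s a" by transfer (rule zeq.add_scale)
  show "zscale r (zscale s a) = zscale (r * s) a" by transfer (rule zeq.scale_scale)
  show "zscale 1 a = a" by transfer (rule zeq.scale_one)
  show "(a + b) \<circ>\<^sub>z c = a \<circ>\<^sub>z c + b \<circ>\<^sub>z c" by transfer (rule zeq.mul_add_left)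
  show "a \<circ>\<^sub>z (b + c) = a \<circ>\<^sub>z b + a \<circ>\<^sub>z c" by transfer (rule zeq.mul_add_right)
  show "zscale r a \<circ>\<^sub>z b = zscale r (a \<circ>\<^sub>z b)" by transfer (rule zeq.mul_scale_left)
  show "a \<circ>\<^sub>z zscale r b = zscale r (a \<circ>\<^sub>z b)" by transfer (rule zeq.mul_scale_right)
  show "a \<circ>\<^sub>z (b \<circ>\<^sub>z c) = (a \<circ>\<^sub>z b + b \<circ>\<^sub>z a) \<circ>\<^sub>z c" by transfer (rule zeq.zinbiel)
qed

text \<open>The letters range over a whole type 'x; the free algebra on a set X of letters (possibly
  empty) is the subalgebra generated by X. Lemma \<open>Zin_universal\<close> below is its universal property.\<close>

definition Zin :: "'x set \<Rightarrow> ('x, 'k::field) zin set" where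
  "Zin X = subalgebra_generated zscale zprod (zgen ` X)"

primrec (in nonassoc_algebra) zeval :: "('x \<Rightarrow> 'a) \<Rightarrow> ('x, 'k) zterm \<Rightarrow> 'a" where
  "zeval h (Gen x) = h x"
| "zeval h Zero = 0"
| "zeval h (Add a b) = zeval h a + zeval h b"
| "zeval h (Scale r a) = scale r (zeval h a)"
| "zeval h (Prod a b) = mul (zeval h a) (zeval h b)"

lemma (in zinbiel_algebra) zeval_cong: "a \<approx> b \<Longrightarrow> zeval h a = zeval h b"
  by (induction rule: zeq.induct)
    (simp_all add: scale_right_distrib scale_left_distrib mul_add_left mul_add_right
      mul_scale_left mul_scale_right zinbiel algebra_simps)

lemma (in zinbiel_algebra) zin_hom_exists:
  "\<exists>\<phi>. algebra_hom_on UNIV zscale zprod scale mul \<phi> \<and> (\<forall>x. \<phi> (zgen x) = h x)"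
proof -
  define \<phi> where "\<phi> a = zeval h (rep_zin a)" for a
  have rep: "\<phi> (abs_zin t) = zeval h t" for t
    unfolding \<phi>_def by (rule zeval_cong) (rule Quotient3_rep_abs[OF Quotient3_zin zeq.refl])
  have "\<phi> (a + b) = \<phi> a + \<phi> b" for a b
    by (induct a rule: zin.abs_induct, induct b rule: zin.abs_induct)
      (simp add: plus_zin.abs_eq rep)
  moreover have "\<phi> (zscale r a) = scale r (\<phi> a)" for r a
    by (induct a rule: zin.abs_induct) (simp add: zscale.abs_eq rep)
  moreover have "\<phi> (a \<circ>\<^sub>z b) = mul (\<phi> a) (\<phi> b)" for a b
    by (induct a rule: zin.abs_induct, induct b rule: zin.abs_induct)
      (simp add: zprod.abs_eq rep)
  moreover have "\<phi> (zgen x) = h x" for x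
    by (simp add: zgen.abs_eq rep)
  ultimately show ?thesis unfolding algebra_hom_on_def by blast
qed

lemma Zin_universal:
  fixes scale :: "'k::field \<Rightarrow> 'a::ab_group_add \<Rightarrow> 'a" and X :: "'x set"
  assumes "zinbiel_algebra scale mul"
  shows "\<exists>\<phi>. algebra_hom_on (Zin X) zscale zprod scale mul \<phi> \<and> (\<forall>x\<in>X. \<phi> (zgen x) = h x)"
    and "algebra_hom_on (Zin X) zscale zprod scale mul \<phi> \<Longrightarrow>
         algebra_hom_on (Zin X) zscale zprod scale mul \<psi> \<Longrightarrow>
         (\<And>x. x \<in> X \<Longrightarrow> \<phi> (zgen x) = \<psi> (zgen x)) \<Longrightarrow> a \<in> Zin X \<Longrightarrow> \<phi> a = \<psi> a"
proof -
  interpret zinbiel_algebra scale mul by fact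
  show "\<exists>\<phi>. algebra_hom_on (Zin X) zscale zprod scale mul \<phi> \<and> (\<forall>x\<in>X. \<phi> (zgen x) = h x)"
    using zin_hom_exists[of h] unfolding algebra_hom_on_def by blast
  assume hom: "algebra_hom_on (Zin X) zscale zprod scale mul \<phi>"
    "algebra_hom_on (Zin X) zscale zprod scale mul \<psi>"
    and gen: "\<And>x. x \<in> X \<Longrightarrow> \<phi> (zgen x) = \<psi> (zgen x)"
  have zero: "\<phi> 0 = 0 \<and> \<psi> 0 = 0"
    using hom sg_zero[of zscale zprod "zgen ` X"] unfolding algebra_hom_on_def Zin_def
    by (metis add_cancel_right_left add_0)
  show "\<phi> a = \<psi> a" if "a \<in> Zin X"
    using that unfolding Zin_def
  proof (induction rule: subalgebra_generated.induct)
    case sg_zero then show ?case using zero by simp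
  next
    case (sg_gen s) then show ?case using gen by auto
  qed (use hom in \<open>simp_all add: algebra_hom_on_def Zin_def\<close>)
qed

section \<open>Words, Jordan elements and the Dynkin map\<close>

definition jprod :: "('x, 'k::field) zin \<Rightarrow> ('x, 'k) zin \<Rightarrow> ('x, 'k) zin" where
  "jprod a b = a \<circ>\<^sub>z b + b \<circ>\<^sub>z a"

definition J :: "'x set \<Rightarrow> ('x, 'k::field) zin set" where
  "J X = subalgebra_generated zscale jprod (zgen ` X)"

text \<open>The empty word has no meaning in the non-unital algebra; it is sent to 0.\<close>

fun left_bracketed ::
  "(('x, 'k::field) zin \<Rightarrow> ('x, 'k) zin \<Rightarrow> ('x, 'k) zin) \<Rightarrow> 'x list \<Rightarrow> ('x, 'k) zin"
where
  "left_bracketed mul [] = 0"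
| "left_bracketed mul (x # xs) = foldl (\<lambda>a y. mul a (zgen y)) (zgen x) xs"

abbreviation zword :: "'x list \<Rightarrow> ('x, 'k::field) zin" where
  "zword \<equiv> left_bracketed zprod"

abbreviation jword :: "'x list \<Rightarrow> ('x, 'k::field) zin" where
  "jword \<equiv> left_bracketed jprod"

definition homogeneous :: "'x set \<Rightarrow> nat \<Rightarrow> ('x, 'k::field) zin set" where
  "homogeneous X n = zin.span {zword xs | xs. length xs = n \<and> set xs \<subseteq> X}"

text \<open>Well defined by \<open>dynkin_ex1\<close> below. Its restriction to \<open>Zin X\<close> is the Dynkin map of \<open>Zin X\<close>.\<close>

definition dynkin :: "('x, 'k::field) zin \<Rightarrow> ('x, 'k) zin" where
  "dynkin = (THE D. Vector_Spaces.linear zscale zscale D \<and> (\<forall>xs. D (zword xs) = jword xs))"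

section \<open>Polynomials without constant term\<close>

text \<open>A monomial is a finitely supported exponent function, and the ring of all polynomials is the
  convolution algebra of finitely supported functions on monomials.\<close>

definition polys_without_const :: "'x set \<Rightarrow> (('x \<Rightarrow>\<^sub>0 nat) \<Rightarrow>\<^sub>0 'k::field) set" where
  "polys_without_const X =
     {p. (\<forall>m \<in> Poly_Mapping.keys p. Poly_Mapping.keys m \<subseteq> X) \<and> Poly_Mapping.lookup p 0 = 0}"

definition poly_scale :: "'k::field \<Rightarrow> (('x \<Rightarrow>\<^sub>0 nat) \<Rightarrow>\<^sub>0 'k) \<Rightarrow> ('x \<Rightarrow>\<^sub>0 nat) \<Rightarrow>\<^sub>0 'k" where
  "poly_scale r = Poly_Mapping.map ((*) r)"

section \<open>The basis of left-bracketed words\<close>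

lemma zword_snoc: "xs \<noteq> [] \<Longrightarrow> zword (xs @ [y]) = zword xs \<circ>\<^sub>z zgen y"
  by (cases xs) simp_all

lemma zin_prod_zero [simp]: "a \<circ>\<^sub>z 0 = 0" "0 \<circ>\<^sub>z a = 0"
  using zin.mul_scale_right[of a 0 0] zin.mul_scale_left[of 0 0 a] by simp_all

lemma zword_mult:
  assumes "set xs \<subseteq> X" "set ys \<subseteq> X"
  shows "zword xs \<circ>\<^sub>z zword ys \<in> zin.span {zword zs | zs. set zs \<subseteq> X}" (is "_ \<in> zin.span ?W")
  using assms
proof (induction "length xs + length ys" arbitrary: xs ys rule: less_induct)
  case less
  show ?case
  proof (cases "xs = [] \<or> ys = []")
    case True
    then show ?thesis by (auto simp: zin.span_zero)
  next
    case False
    then obtain vs y where ys: "ys = vs @ [y]" by (metis rev_exhaust)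
    show ?thesis
    proof (cases "vs = []")
      case True
      have "zword xs \<circ>\<^sub>z zword ys = zword (xs @ [y])"
        using False True ys by (simp add: zword_snoc)
      moreover have "set (xs @ [y]) \<subseteq> X" using less.prems ys by auto
      ultimately have "zword xs \<circ>\<^sub>z zword ys \<in> ?W" by blast
      then show ?thesis by (rule zin.span_base)
    next
      case vs: False
      have eq: "zword xs \<circ>\<^sub>z zword ys =
          (zword xs \<circ>\<^sub>z zword vs + zword vs \<circ>\<^sub>z zword xs) \<circ>\<^sub>z zgen y"
        using vs ys by (simp add: zword_snoc zin.zinbiel)
      have "zword xs \<circ>\<^sub>z zword vs + zword vs \<circ>\<^sub>z zword xs \<in> zin.span ?W"
        using less.prems ys by (intro zin.span_add less.hyps) auto
      moreover have "a \<circ>\<^sub>z zgen y \<in> zin.span ?W" if "a \<in> zin.span ?W" for a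
        using that
      proof (induction rule: zin.span_induct_alt)
        case base
        then show ?case by (simp add: zin.span_zero)
      next
        case (step c w b)
        then obtain zs where zs: "w = zword zs" "set zs \<subseteq> X" by auto
        have "w \<circ>\<^sub>z zgen y \<in> zin.span ?W"
        proof (cases "zs = []")
          case True then show ?thesis using zs by (simp add: zin.span_zero)
        next
          case False
          then have "w \<circ>\<^sub>z zgen y = zword (zs @ [y])" using zs by (simp add: zword_snoc)
          moreover have "set (zs @ [y]) \<subseteq> X" using zs ys less.prems by auto
          ultimately have "w \<circ>\<^sub>z zgen y \<in> ?W" by blast
          then show ?thesis by (rule zin.span_base)
        qed
        then show ?case using step
          by (simp add: zin.mul_add_left zin.mul_scale_left zin.span_add zin.span_scale)
      qed
      ultimately show ?thesis unfolding eq by blast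
    qed
  qed
qed

lemma zword_in_Zin: "set xs \<subseteq> X \<Longrightarrow> zword xs \<in> Zin X"
proof (induction xs rule: rev_induct)
  case Nil then show ?case by (simp add: Zin_def sg_zero)
next
  case (snoc y xs)
  have y: "zgen y \<in> Zin X" using snoc.prems by (auto simp: Zin_def intro: sg_gen)
  show ?case
  proof (cases "xs = []")
    case True then show ?thesis using y by simp
  next
    case False
    then show ?thesis using snoc y by (auto simp: zword_snoc Zin_def intro: sg_prod)
  qed
qed

lemma zin_span_mult:
  assumes "a \<in> zin.span {zword zs | zs. set zs \<subseteq> X}" (is "_ \<in> zin.span ?W")
    and b: "b \<in> zin.span {zword zs | zs. set zs \<subseteq> X}"
  shows "a \<circ>\<^sub>z b \<in> zin.span {zword zs | zs. set zs \<subseteq> X}"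
  using assms(1)
proof (induction rule: zin.span_induct_alt)
  case base
  then show ?case by (simp add: zin.span_zero)
next
  case (step c w d)
  have "w \<circ>\<^sub>z b \<in> zin.span ?W"
    using b
  proof (induction rule: zin.span_induct_alt)
    case base
    then show ?case by (simp add: zin.span_zero)
  next
    case (step c' w' d')
    then show ?case using zword_mult[of _ X] \<open>w \<in> ?W\<close>
      by (auto simp: zin.mul_add_right zin.mul_scale_right intro!: zin.span_add zin.span_scale)
  qed
  then show ?case using step
    by (simp add: zin.mul_add_left zin.mul_scale_left zin.span_add zin.span_scale)
qed

lemma Zin_eq_span:
  "(Zin X :: ('x, 'k::field) zin set) = zin.span {zword zs | zs. set zs \<subseteq> X}" (is "_ = zin.span ?W")
proof
  show "Zin X \<subseteq> zin.span ?W"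
  proof
    fix a :: "('x, 'k) zin" assume "a \<in> Zin X"
    then show "a \<in> zin.span ?W"
      unfolding Zin_def
    proof (induction rule: subalgebra_generated.induct)
      case (sg_gen s)
      then obtain x where x: "s = zword [x]" "set [x] \<subseteq> X" by auto
      have "s \<in> ?W" using x by blast
      then show ?case by (rule zin.span_base)
    qed (auto simp: zin.span_zero zin.span_add zin.span_scale zin_span_mult)
  qed
  show "zin.span ?W \<subseteq> Zin X"
  proof
    fix a :: "('x, 'k) zin" assume "a \<in> zin.span ?W"
    then show "a \<in> Zin X"
    proof (induction rule: zin.span_induct_alt)
      case base
      then show ?case by (simp add: Zin_def sg_zero)
    next
      case (step c w b)
      then have "w \<in> Zin X" using zword_in_Zin by auto
      then show ?case using step unfolding Zin_def by (intro sg_add sg_scale)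
    qed
  qed
qed

lemma abs_zin_in_Zin: "abs_zin t \<in> Zin UNIV"
proof (induction t)
  case (Gen x)
  then show ?case by (auto simp: Zin_def zgen.abs_eq[symmetric] intro: sg_gen)
qed (auto simp: Zin_def zero_zin.abs_eq[symmetric] plus_zin.abs_eq[symmetric]
    zscale.abs_eq[symmetric] zprod.abs_eq[symmetric]
    intro: sg_zero sg_add sg_scale sg_prod)

lemma Zin_UNIV: "Zin UNIV = UNIV"
proof -
  have "a \<in> Zin UNIV" for a :: "('x, 'k::field) zin"
    by (induct a rule: zin.abs_induct) (rule abs_zin_in_Zin)
  then show ?thesis by blast
qed

text \<open>For linear independence: functions on words with the half-shuffle product, which keeps the last
  letter of the right factor last. Words are stored in reverse, so this letter is the head.\<close>

definition lder :: "'x \<Rightarrow> ('x list \<Rightarrow> 'k) \<Rightarrow> 'x list \<Rightarrow> 'k" where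
  "lder x f = (\<lambda>w. f (x # w))"

definition nocst :: "('x list \<Rightarrow> 'k::field) \<Rightarrow> 'x list \<Rightarrow> 'k" where
  "nocst f = (\<lambda>w. if w = [] then 0 else f w)"

primrec shuf :: "'x list \<Rightarrow> ('x list \<Rightarrow> 'k::field) \<Rightarrow> ('x list \<Rightarrow> 'k) \<Rightarrow> 'k" where
  "shuf [] f g = f [] * g []"
| "shuf (x # w) f g = shuf w (lder x f) g + shuf w f (lder x g)"

primrec half0 :: "'x list \<Rightarrow> ('x list \<Rightarrow> 'k::field) \<Rightarrow> ('x list \<Rightarrow> 'k) \<Rightarrow> 'k" where
  "half0 [] f g = 0"
| "half0 (x # w) f g = shuf w (nocst f) (lder x g)"

definition half :: "('x list \<Rightarrow> 'k::field) \<Rightarrow> ('x list \<Rightarrow> 'k) \<Rightarrow> 'x list \<Rightarrow> 'k" where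
  "half f g = (\<lambda>w. half0 w f g)"

definition fscale :: "'k::field \<Rightarrow> ('x list \<Rightarrow> 'k) \<Rightarrow> 'x list \<Rightarrow> 'k" where
  "fscale r f = (\<lambda>w. r * f w)"

lemma fscale_apply: "fscale r f w = r * f w"
  by (simp add: fscale_def)

lemma lder_simps:
  "lder x (f + g) = lder x f + lder x g" "lder x (fscale r f) = fscale r (lder x f)"
  "lder x (nocst f) = lder x f"
  by (simp_all add: lder_def fscale_def nocst_def fun_eq_iff)

lemma nocst_simps:
  "nocst (f + g) = nocst f + nocst g" "nocst (fscale r f) = fscale r (nocst f)"
  by (simp_all add: fscale_def nocst_def fun_eq_iff)

lemma shuf_comm: "shuf w f g = shuf w g f"
  by (induction w arbitrary: f g) (auto simp: mult.commute add.commute)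

lemma shuf_add_left: "shuf w (f + f') g = shuf w f g + shuf w f' g"
  by (induction w arbitrary: f f' g) (auto simp: lder_simps algebra_simps)

lemma shuf_add_right: "shuf w f (g + g') = shuf w f g + shuf w f g'"
  by (metis shuf_add_left shuf_comm)

lemma shuf_scale_left: "shuf w (fscale r f) g = r * shuf w f g"
  by (induction w arbitrary: f g) (auto simp: lder_simps algebra_simps fscale_apply)

lemma shuf_scale_right: "shuf w f (fscale r g) = r * shuf w f g"
  by (metis shuf_scale_left shuf_comm)

lemma lder_shuf:
  "lder x (\<lambda>w. shuf w f g) = (\<lambda>w. shuf w (lder x f) g) + (\<lambda>w. shuf w f (lder x g))"
  by (simp add: lder_def fun_eq_iff)

lemma shuf_assoc: "shuf w f (\<lambda>w. shuf w g h) = shuf w (\<lambda>w. shuf w f g) h"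
  by (induction w arbitrary: f g h)
    (auto simp: lder_shuf shuf_add_left shuf_add_right algebra_simps)

lemma nocst_half: "nocst (half f g + half g f) = (\<lambda>w. shuf w (nocst f) (nocst g))"
proof
  fix w show "nocst (half f g + half g f) w = shuf w (nocst f) (nocst g)"
  proof (cases w)
    case (Cons x v)
    then have "nocst (half f g + half g f) w = half f g w + half g f w"
      by (simp add: nocst_def)
    then show ?thesis using Cons
      by (simp add: half_def lder_simps shuf_comm[of v "nocst g"] add.commute)
  qed (simp add: nocst_def)
qed

interpretation hs: zinbiel_algebra fscale half
proof
  fix a b c :: "'x list \<Rightarrow> 'k::field" and r s :: 'k
  show "fscale r (a + b) = fscale r a + fscale r b" by (auto simp: fscale_def algebra_simps)
  show "fscale (r + s) a = fscale r a + fscale s a" by (auto simp: fscale_def algebra_simps)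
  show "fscale r (fscale s a) = fscale (r * s) a" by (auto simp: fscale_def algebra_simps)
  show "fscale 1 a = a" by (auto simp: fscale_def)
  have ext: "f = g" if "\<And>x w. f (x # w) = g (x # w)" "f [] = g []" for f g :: "'x list \<Rightarrow> 'k"
    using that by (metis neq_Nil_conv ext)
  show "half (a + b) c = half a c + half b c"
    by (rule ext) (auto simp: half_def nocst_simps shuf_add_left)
  show "half a (b + c) = half a b + half a c"
    by (rule ext) (auto simp: half_def lder_simps shuf_add_right)
  show "half (fscale r a) b = fscale r (half a b)"
    by (rule ext) (auto simp: half_def nocst_simps shuf_scale_left fscale_apply)
  show "half a (fscale r b) = fscale r (half a b)"
    by (rule ext) (auto simp: half_def lder_simps shuf_scale_right fscale_apply)
  have der: "lder x (half b c) = (\<lambda>w. shuf w (nocst b) (lder x c))" for x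
    by (simp add: half_def lder_def)
  show "half a (half b c) = half (half a b + half b a) c"
  proof (rule ext)
    fix x w
    have "half a (half b c) (x # w) = shuf w (nocst a) (lder x (half b c))"
      by (simp add: half_def)
    also have "\<dots> = shuf w (nocst (half a b + half b a)) (lder x c)"
      by (simp add: der nocst_half shuf_assoc)
    finally show "half a (half b c) (x # w) = half (half a b + half b a) c (x # w)"
      by (simp add: half_def)
  qed (simp add: half_def)
qed

lemma half_letter:
  "half f (\<lambda>w. if w = [y] then 1 else 0) = (\<lambda>w. if w \<noteq> [] \<and> hd w = y then nocst f (tl w) else 0)"
proof
  fix w :: "'a list"
  have unit: "shuf v g (\<lambda>w. if w = [] then 1 else 0) = g v" for v and g :: "'a list \<Rightarrow> 'b"
  proof (induction v arbitrary: g)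
    case (Cons x v)
    have "lder x (\<lambda>w. if w = [] then 1 else 0 :: 'b) = fscale 0 (\<lambda>_. 0)"
      by (auto simp: lder_def fscale_def)
    then have "shuf v g (lder x (\<lambda>w. if w = [] then 1 else 0)) = 0" for g :: "'a list \<Rightarrow> 'b"
      by (simp only: shuf_scale_right mult_zero_left)
    then show ?case using Cons.IH[of "lder x g"] by (simp add: lder_def)
  qed simp
  show "half f (\<lambda>w. if w = [y] then 1 else 0) w = (if w \<noteq> [] \<and> hd w = y then nocst f (tl w) else 0)"
  proof (cases w)
    case (Cons x v)
    have "lder x (\<lambda>w. if w = [y] then 1 else 0 :: 'b) =
        fscale (if x = y then 1 else 0) (\<lambda>w. if w = [] then 1 else 0)"
      by (auto simp: lder_def fscale_def)
    then show ?thesis using Cons by (simp add: half_def shuf_scale_right unit)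
  qed (simp add: half_def)
qed

lemma zword_separation:
  "\<exists>\<phi> :: ('x, 'k::field) zin \<Rightarrow> 'x list \<Rightarrow> 'k. Vector_Spaces.linear zscale fscale \<phi> \<and>
     (\<forall>xs. xs \<noteq> [] \<longrightarrow> \<phi> (zword xs) = (\<lambda>w. if w = rev xs then 1 else 0))"
proof -
  obtain \<phi> :: "('x, 'k) zin \<Rightarrow> 'x list \<Rightarrow> 'k" where
    hom: "algebra_hom_on UNIV zscale zprod fscale half \<phi>" and
    gen: "\<And>x. \<phi> (zgen x) = (\<lambda>w. if w = [x] then 1 else 0)"
    using hs.zin_hom_exists[of "\<lambda>x w. if w = [x] then 1 else 0"] by auto
  have "Vector_Spaces.linear zscale fscale \<phi>"
    using hom unfolding algebra_hom_on_def
    by (intro Vector_Spaces.linear.intro module_hom.intro module_hom_axioms.intro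
        zin.vector_space_axioms hs.vector_space_axioms zin.module_axioms hs.module_axioms) auto
  moreover have "\<phi> (zword xs) = (\<lambda>w. if w = rev xs then 1 else 0)" if "xs \<noteq> []" for xs
    using that
  proof (induction xs rule: rev_induct)
    case (snoc y xs)
    show ?case
    proof (cases "xs = []")
      case True then show ?thesis using gen by simp
    next
      case False
      have "\<phi> (zword (xs @ [y])) = half (\<phi> (zword xs)) (\<phi> (zgen y))"
        using False hom by (simp add: zword_snoc algebra_hom_on_def)
      also have "\<dots> = (\<lambda>w. if w = rev (xs @ [y]) then 1 else 0)"
        unfolding gen half_letter snoc.IH[OF False] nocst_def
        using False by (auto simp: fun_eq_iff neq_Nil_conv)
      finally show ?thesis .
    qed
  qed simp
  ultimately show ?thesis by blast
qed

lemma zword_inj: "inj_on (zword :: 'x list \<Rightarrow> ('x, 'k::field) zin) {xs. xs \<noteq> []}"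
proof (rule inj_onI)
  fix xs ys :: "'x list"
  assume *: "xs \<in> {xs. xs \<noteq> []}" "ys \<in> {xs. xs \<noteq> []}"
    and eq: "(zword xs :: ('x, 'k) zin) = zword ys"
  obtain \<phi> :: "('x, 'k) zin \<Rightarrow> 'x list \<Rightarrow> 'k" where
    \<phi>: "\<And>xs. xs \<noteq> [] \<Longrightarrow> \<phi> (zword xs) = (\<lambda>w. if w = rev xs then 1 else 0)"
    using zword_separation by blast
  have "(\<lambda>w. if w = rev xs then 1 else 0 :: 'k) = (\<lambda>w. if w = rev ys then 1 else 0)"
    using \<phi>[of xs] \<phi>[of ys] * eq by simp
  then have "(if rev xs = rev xs then 1 else 0 :: 'k) = (if rev xs = rev ys then 1 else 0)"
    by (rule fun_cong)
  then show "xs = ys" by (simp split: if_splits)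
qed

lemma zword_independent:
  "zin.independent ((zword :: 'x list \<Rightarrow> ('x, 'k::field) zin) ` {xs. xs \<noteq> []})"
  unfolding zin.dependent_explicit
proof -
  obtain \<phi> :: "('x, 'k) zin \<Rightarrow> 'x list \<Rightarrow> 'k" where
    lin: "Vector_Spaces.linear zscale fscale \<phi>" and
    \<phi>: "\<And>xs. xs \<noteq> [] \<Longrightarrow> \<phi> (zword xs) = (\<lambda>w. if w = rev xs then 1 else 0)"
    using zword_separation by blast
  interpret \<phi>: Vector_Spaces.linear zscale fscale \<phi> by fact
  show "\<not> (\<exists>t u. finite t \<and> t \<subseteq> (zword :: 'x list \<Rightarrow> ('x, 'k) zin) ` {xs. xs \<noteq> []} \<and>
      (\<Sum>v\<in>t. zscale (u v) v) = 0 \<and> (\<exists>v\<in>t. u v \<noteq> 0))"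
  proof clarify
    fix t and u :: "('x, 'k) zin \<Rightarrow> 'k" and v
    assume t: "finite t" "t \<subseteq> zword ` {xs. xs \<noteq> []}" and s: "(\<Sum>v\<in>t. zscale (u v) v) = 0"
      and v: "v \<in> t" "u v \<noteq> 0"
    obtain xs where xs: "v = zword xs" "xs \<noteq> []" using t v by auto
    have app: "(\<Sum>v\<in>t. f v) w = (\<Sum>v\<in>t. f v w)" for f :: "('x, 'k) zin \<Rightarrow> 'x list \<Rightarrow> 'k" and w
      using t(1) by (induction t) auto
    have "\<phi> (\<Sum>v\<in>t. zscale (u v) v) = 0" using s by (simp add: \<phi>.zero)
    then have "(\<Sum>v\<in>t. fscale (u v) (\<phi> v)) = 0" by (simp add: \<phi>.sum \<phi>.scale)
    then have "(\<Sum>v\<in>t. fscale (u v) (\<phi> v)) (rev xs) = 0" by simp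
    then have "(\<Sum>v\<in>t. u v * \<phi> v (rev xs)) = 0" by (simp add: app fscale_def)
    also have "(\<Sum>v\<in>t. u v * \<phi> v (rev xs)) = (\<Sum>w\<in>t. if w = v then u v else 0)"
    proof (rule sum.cong)
      fix w assume "w \<in> t"
      then obtain ys where ys: "w = zword ys" "ys \<noteq> []" using t by auto
      have "w = v \<longleftrightarrow> ys = xs"
        using ys xs inj_on_eq_iff[OF zword_inj, of ys xs] by simp
      then show "u w * \<phi> w (rev xs) = (if w = v then u v else 0)"
        using xs ys by (auto simp: \<phi>)
    qed simp
    finally show False using t v by simp
  qed
qed

lemma dynkin_ex1:
  "\<exists>!D :: ('x, 'k::field) zin \<Rightarrow> ('x, 'k) zin.
     Vector_Spaces.linear zscale zscale D \<and> (\<forall>xs. D (zword xs) = jword xs)"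
proof -
  interpret vp: vector_space_pair "zscale :: 'k \<Rightarrow> ('x, 'k) zin \<Rightarrow> _" "zscale :: 'k \<Rightarrow> ('x, 'k) zin \<Rightarrow> _"
    by unfold_locales
  obtain D where D: "Vector_Spaces.linear zscale zscale D"
    "\<forall>b \<in> (zword :: 'x list \<Rightarrow> ('x, 'k) zin) ` {xs. xs \<noteq> []}.
       D b = jword (inv_into {xs. xs \<noteq> []} (zword :: 'x list \<Rightarrow> ('x, 'k) zin) b)"
    using vp.linear_independent_extend[OF zword_independent] by meson
  have "D (zword xs) = jword xs" for xs
  proof (cases "xs = []")
    case True
    then show ?thesis using vp.linear_0[OF D(1)] by simp
  next
    case False
    then show ?thesis using D(2) by (simp add: inv_into_f_f[OF zword_inj])
  qed
  with D have "Vector_Spaces.linear zscale zscale D \<and> (\<forall>xs. D (zword xs) = jword xs)" by blast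
  moreover have "D' = D" if "Vector_Spaces.linear zscale zscale D' \<and> (\<forall>xs. D' (zword xs) = jword xs)"
    for D'
  proof
    fix a :: "('x, 'k) zin"
    have "a \<in> zin.span {zword zs | zs. set zs \<subseteq> UNIV}"
      unfolding Zin_eq_span[symmetric] Zin_UNIV by simp
    then show "D' a = D a"
      using that D(1) \<open>\<And>xs. D (zword xs) = jword xs\<close>
      by (intro vp.linear_eq_on[of D' D a "{zword zs | zs. set zs \<subseteq> UNIV}"]) auto
  qed
  ultimately show ?thesis by blast
qed

end

theory Submission
  imports Defs "HOL-Library.Multiset"
begin

text \<open>
  Let \<open>d\<close> be the Euler operator on polynomials, multiplying a monomial by its degree, let \<open>I\<close> be its
  inverse on polynomials without constant term, and let \<open>Z\<close> remove the constant term. Then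
  \<open>I (Z p * d q)\<close> is a Zinbiel product on polynomials whose symmetrization is the ordinary product
  of \<open>Z p\<close> and \<open>Z q\<close>, because \<open>d\<close> is a derivation. So the free Zinbiel algebra has a homomorphism
  \<open>\<phi>\<close> to polynomials, which sends a word of length \<open>n\<close> to its monomial divided by \<open>n!\<close> and a
  left-bracketed Jordan word to its monomial. As \<open>{,}\<close> is commutative and associative, a Jordan word
  depends on its monomial only, which defines a linear map \<open>\<psi>\<close> in the other direction. Jordan words
  span \<open>J X\<close>, so \<open>\<psi> \<circ> \<phi>\<close> is the identity on \<open>J X\<close>; and on words of length \<open>n\<close> the Dynkin map is
  \<open>n! (\<psi> \<circ> \<phi>)\<close>.
\<close>

section \<open>A Zinbiel product on polynomials\<close>

abbreviation lookup :: "('a \<Rightarrow>\<^sub>0 'b::zero) \<Rightarrow> 'a \<Rightarrow> 'b" where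
  "lookup \<equiv> Poly_Mapping.lookup"

lemma poly_mapping_sum_single: "p = (\<Sum>m\<in>Poly_Mapping.keys p. Poly_Mapping.single m (lookup p m))"
  by (rule poly_mapping_eqI)
    (auto simp: lookup_sum lookup_single when_def in_keys_iff sum.delta' if_distrib cong: if_cong)

text \<open>Additive identities reduce to one-term functions. The rule serves for polynomials and,
  in \<open>ex_expo\<close>, for exponents.\<close>

lemma poly_mapping_single_induct [case_names zero add]:
  fixes p :: "'a \<Rightarrow>\<^sub>0 'b::comm_monoid_add"
  assumes "P 0" "\<And>p m c. P p \<Longrightarrow> P (Poly_Mapping.single m c + p)"
  shows "P p"
proof -
  have "P (\<Sum>m\<in>M. Poly_Mapping.single m (lookup p m))" if "finite M" for M
    using that assms by (induction M rule: finite_induct) simp_all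
  from this[of "Poly_Mapping.keys p"] show ?thesis by (simp flip: poly_mapping_sum_single)
qed

lemma lookup_poly_scale [simp]: "lookup (poly_scale r p) m = r * lookup p m"
  unfolding poly_scale_def by (auto simp: Poly_Mapping.map.rep_eq when_def)

text \<open>The operators d, I and Z are all diagonal on monomials, so their linearity is proved
  once for this form.\<close>

definition weighted ::
  "(('x \<Rightarrow>\<^sub>0 nat) \<Rightarrow> 'k::field) \<Rightarrow> (('x \<Rightarrow>\<^sub>0 nat) \<Rightarrow>\<^sub>0 'k) \<Rightarrow> ('x \<Rightarrow>\<^sub>0 nat) \<Rightarrow>\<^sub>0 'k" where
  "weighted f p = Poly_Mapping.mapp (\<lambda>m c. f m * c) p"

lemma lookup_weighted [simp]: "lookup (weighted f p) m = f m * lookup p m"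
  by (simp add: weighted_def lookup_mapp when_def in_keys_iff)

lemma weighted_add: "weighted f (p + q) = weighted f p + weighted f q"
  by (rule poly_mapping_eqI) (simp add: lookup_add algebra_simps)

lemma weighted_zero [simp]: "weighted f 0 = 0"
  by (rule poly_mapping_eqI) simp

lemma weighted_poly_scale: "weighted f (poly_scale r p) = poly_scale r (weighted f p)"
  by (rule poly_mapping_eqI) simp

lemma weighted_single [simp]:
  "weighted f (Poly_Mapping.single m c) = Poly_Mapping.single m (f m * c)"
  by (rule poly_mapping_eqI) (simp add: lookup_single when_def)

lemma poly_scale_single [simp]:
  "poly_scale r (Poly_Mapping.single m c) = Poly_Mapping.single m (r * c)"
  by (rule poly_mapping_eqI) (simp add: lookup_single when_def)

lemma poly_scale_add: "poly_scale r (p + q) = poly_scale r p + poly_scale r q"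
  by (rule poly_mapping_eqI) (simp add: lookup_add algebra_simps)

text \<open>Lets scalars move through products by the laws of a commutative ring.\<close>

lemma poly_scale_eq_mult: "poly_scale r p = Poly_Mapping.single 0 r * p"
proof (induction p rule: poly_mapping_single_induct)
  case zero
  show ?case by (rule poly_mapping_eqI) simp
next
  case (add p m c)
  then show ?case by (simp add: poly_scale_add ring_distribs mult_single)
qed

text \<open>Both sides are additive in p and in q, and on two monomials the additivity of f is
  exactly the Leibniz rule.\<close>

lemma weighted_derivation:
  assumes "\<And>m m'. f (m + m') = f m + f m'"
  shows "weighted f (p * q) = weighted f p * q + p * weighted f q"
proof (induction p rule: poly_mapping_single_induct)
  case (add p m c)
  have "weighted f (Poly_Mapping.single m c * q) =
      weighted f (Poly_Mapping.single m c) * q + Poly_Mapping.single m c * weighted f q"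
  proof (induction q rule: poly_mapping_single_induct)
    case (add q m' c')
    have "weighted f (Poly_Mapping.single m c * Poly_Mapping.single m' c') =
        weighted f (Poly_Mapping.single m c) * Poly_Mapping.single m' c' +
        Poly_Mapping.single m c * weighted f (Poly_Mapping.single m' c')"
      by (simp add: mult_single assms algebra_simps flip: single_add)
    with add show ?case by (simp add: weighted_add ring_distribs)
  qed simp
  with add show ?case by (simp add: weighted_add ring_distribs)
qed simp

section \<open>Degree and the Euler operator\<close>

definition deg :: "('x \<Rightarrow>\<^sub>0 nat) \<Rightarrow> nat" where
  "deg m = (\<Sum>x\<in>Poly_Mapping.keys m. lookup m x)"

lemma deg_add: "deg (m + m') = deg m + deg m'"
  unfolding deg_def using setsum_keys_plus_distrib[of "\<lambda>_ n. n" m m'] by simp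

lemma deg_eq_0_iff [simp]: "deg m = 0 \<longleftrightarrow> m = 0"
proof
  assume "deg m = 0"
  then have "lookup m x = 0" for x
    by (cases "x \<in> Poly_Mapping.keys m") (auto simp: deg_def in_keys_iff)
  then show "m = 0" by (simp add: poly_mapping_eqI)
qed (simp add: deg_def)

lemma deg_single [simp]: "deg (Poly_Mapping.single x n) = n"
  by (simp add: deg_def)

definition euler :: "(('x \<Rightarrow>\<^sub>0 nat) \<Rightarrow>\<^sub>0 'k::field) \<Rightarrow> ('x \<Rightarrow>\<^sub>0 nat) \<Rightarrow>\<^sub>0 'k" where
  "euler = weighted (\<lambda>m. of_nat (deg m))"

text \<open>The constant term is sent to \<open>0\<close>, because \<open>inverse 0 = 0\<close>.\<close>

definition euler_inv :: "(('x \<Rightarrow>\<^sub>0 nat) \<Rightarrow>\<^sub>0 'k::field) \<Rightarrow> ('x \<Rightarrow>\<^sub>0 nat) \<Rightarrow>\<^sub>0 'k" where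
  "euler_inv = weighted (\<lambda>m. inverse (of_nat (deg m)))"

definition drop_const :: "(('x \<Rightarrow>\<^sub>0 nat) \<Rightarrow>\<^sub>0 'k::field) \<Rightarrow> ('x \<Rightarrow>\<^sub>0 nat) \<Rightarrow>\<^sub>0 'k" where
  "drop_const = weighted (\<lambda>m. if m = 0 then 0 else 1)"

lemma drop_const_ident: "lookup p 0 = 0 \<Longrightarrow> drop_const p = p"
  unfolding drop_const_def by (rule poly_mapping_eqI) auto

lemma lookup_drop_const_0: "lookup (drop_const p) 0 = 0"
  by (simp add: drop_const_def)

lemma euler_mult: "euler (p * q) = euler p * q + p * euler q"
  unfolding euler_def by (rule weighted_derivation) (simp add: deg_add)

text \<open>Polynomials without constant term form an ideal: degrees are natural numbers, so a
  product of monomials is constant only if both factors are.\<close>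

lemma drop_const_mult: "drop_const (p * drop_const q) = p * drop_const q"
proof (induction p rule: poly_mapping_single_induct)
  case (add p m c)
  have "drop_const (Poly_Mapping.single m c * drop_const q) =
      Poly_Mapping.single m c * drop_const q"
  proof (induction q rule: poly_mapping_single_induct)
    case (add q m' c')
    have "m + m' = 0 \<Longrightarrow> m' = 0"
      by (metis deg_add deg_eq_0_iff add_is_0)
    then have "drop_const (Poly_Mapping.single m c * drop_const (Poly_Mapping.single m' c')) =
        Poly_Mapping.single m c * drop_const (Poly_Mapping.single m' c')"
      by (auto simp: drop_const_def mult_single)
    with add show ?case by (simp add: drop_const_def weighted_add ring_distribs)
  qed (simp add: drop_const_def)
  with add show ?case by (simp add: drop_const_def weighted_add ring_distribs)
qed (simp add: drop_const_def)

lemma euler_drop_const [simp]: "euler (drop_const p) = euler p"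
  "drop_const (euler p) = euler p"
  by (rule poly_mapping_eqI, simp add: euler_def drop_const_def deg_def)+

text \<open>Characteristic 0 makes every nonzero degree invertible; in degree 0 both sides
  vanish.\<close>

lemma euler_inv_euler:
  fixes p :: "('x \<Rightarrow>\<^sub>0 nat) \<Rightarrow>\<^sub>0 'k::field_char_0"
  shows "euler_inv (euler p) = drop_const p" "euler (euler_inv p) = drop_const p"
  by (rule poly_mapping_eqI, simp add: euler_def euler_inv_def drop_const_def)+

text \<open>In one variable this is the integral of p q' from 0, with p stripped of its constant
  term. The stripping makes the Zinbiel law hold for constants too.\<close>

definition poly_zin ::
  "(('x \<Rightarrow>\<^sub>0 nat) \<Rightarrow>\<^sub>0 'k::field) \<Rightarrow> (('x \<Rightarrow>\<^sub>0 nat) \<Rightarrow>\<^sub>0 'k) \<Rightarrow> ('x \<Rightarrow>\<^sub>0 nat) \<Rightarrow>\<^sub>0 'k" where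
  "poly_zin p q = euler_inv (drop_const p * euler q)"

lemma poly_zin_symmetrized:
  fixes p q :: "('x \<Rightarrow>\<^sub>0 nat) \<Rightarrow>\<^sub>0 'k::field_char_0"
  shows "poly_zin p q + poly_zin q p = drop_const p * drop_const q"
proof -
  have "poly_zin p q + poly_zin q p =
      euler_inv (drop_const p * euler q + drop_const q * euler p)"
    by (simp add: poly_zin_def euler_inv_def weighted_add)
  also have "\<dots> = euler_inv (euler (drop_const p * drop_const q))"
    by (simp add: euler_mult ac_simps)
  finally show ?thesis by (simp add: euler_inv_euler drop_const_mult)
qed

interpretation poly: zinbiel_algebra
  "poly_scale :: 'k::field_char_0 \<Rightarrow> (('x \<Rightarrow>\<^sub>0 nat) \<Rightarrow>\<^sub>0 'k) \<Rightarrow> _" poly_zin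
proof
  fix a b c :: "('x \<Rightarrow>\<^sub>0 nat) \<Rightarrow>\<^sub>0 'k" and r s :: 'k
  show "poly_scale r (a + b) = poly_scale r a + poly_scale r b" by (rule poly_scale_add)
  show "poly_scale (r + s) a = poly_scale r a + poly_scale s a"
    by (rule poly_mapping_eqI) (simp add: lookup_add algebra_simps)
  show "poly_scale r (poly_scale s a) = poly_scale (r * s) a"
    by (rule poly_mapping_eqI) simp
  show "poly_scale 1 a = a" by (rule poly_mapping_eqI) simp
  show "poly_zin (a + b) c = poly_zin a c + poly_zin b c"
    by (simp add: poly_zin_def euler_inv_def euler_def drop_const_def weighted_add ring_distribs)
  show "poly_zin a (b + c) = poly_zin a b + poly_zin a c"
    by (simp add: poly_zin_def euler_inv_def euler_def drop_const_def weighted_add ring_distribs)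
  have scale_mult: "poly_scale r p * q = poly_scale r (p * q)"
    "p * poly_scale r q = poly_scale r (p * q)" for p q :: "('x \<Rightarrow>\<^sub>0 nat) \<Rightarrow>\<^sub>0 'k"
    by (simp_all add: poly_scale_eq_mult ac_simps)
  show "poly_zin (poly_scale r a) b = poly_scale r (poly_zin a b)"
    by (simp add: poly_zin_def euler_inv_def drop_const_def weighted_poly_scale scale_mult)
  show "poly_zin a (poly_scale r b) = poly_scale r (poly_zin a b)"
    by (simp add: poly_zin_def euler_inv_def euler_def weighted_poly_scale scale_mult)
  \<comment> \<open>Both sides of the Zinbiel law equal I (Z a * Z b * d c). On the left d cancels I
    up to Z, which fixes a product having a factor without constant term; on the right the
    symmetrized product is Z a * Z b.\<close>
  have "poly_zin a (poly_zin b c) =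
      euler_inv (drop_const a * drop_const (drop_const b * drop_const (euler c)))"
    by (simp add: poly_zin_def euler_inv_euler)
  also have "\<dots> = euler_inv (drop_const a * (drop_const b * drop_const (euler c)))"
    by (simp only: drop_const_mult)
  also have "\<dots> = euler_inv (drop_const (drop_const a * drop_const b) * euler c)"
    by (simp only: drop_const_mult euler_drop_const mult.assoc)
  finally show "poly_zin a (poly_zin b c) = poly_zin (poly_zin a b + poly_zin b a) c"
    by (simp only: poly_zin_symmetrized) (simp add: poly_zin_def)
qed

section \<open>Jordan words\<close>

lemma jprod_comm: "jprod a b = jprod b a"
  by (simp add: jprod_def add.commute)

text \<open>By the Zinbiel identity both sides expand to {a,b} \<circ> c + {a,c} \<circ> b + {b,c}
  \<circ> a.\<close>

lemma jprod_assoc: "jprod (jprod a b) c = jprod a (jprod b c)"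
  by (simp add: jprod_def zin.mul_add_left zin.mul_add_right zin.zinbiel algebra_simps)

lemma jprod_add: "jprod (a + b) c = jprod a c + jprod b c" "jprod a (b + c) = jprod a b + jprod a c"
  by (simp_all add: jprod_def zin.mul_add_left zin.mul_add_right algebra_simps)

lemma jprod_scale:
  "jprod (zscale r a) b = zscale r (jprod a b)" "jprod a (zscale r b) = zscale r (jprod a b)"
  by (simp_all add: jprod_def zin.mul_scale_left zin.mul_scale_right zin.scale_right_distrib)

lemma jprod_zero [simp]: "jprod a 0 = 0" "jprod 0 a = 0"
  by (simp_all add: jprod_def)

lemma jword_snoc: "xs \<noteq> [] \<Longrightarrow> jword (xs @ [y]) = jprod (jword xs) (zgen y)"
  by (cases xs) simp_all

lemma jword_append: "xs \<noteq> [] \<Longrightarrow> ys \<noteq> [] \<Longrightarrow> jword (xs @ ys) = jprod (jword xs) (jword ys)"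
proof (induction ys rule: rev_induct)
  case (snoc y ys)
  show ?case
  proof (cases "ys = []")
    case True
    then show ?thesis using snoc.prems by (simp add: jword_snoc)
  next
    case False
    then show ?thesis using snoc jword_snoc[of "xs @ ys" y, where 'b = 'b]
      by (simp add: jword_snoc jprod_assoc)
  qed
qed simp

lemma jword_append_comm: "jword (xs @ ys) = jword (ys @ xs)"
  by (cases "xs = [] \<or> ys = []") (auto simp: jword_append jprod_comm)

text \<open>Swapping two blocks of \<open>ys\<close> brings the first letter of the other word to
  the front; induction compares the tails.\<close>

lemma jword_mset: "mset xs = mset ys \<Longrightarrow> (jword xs :: ('x, 'k::field) zin) = jword ys"
proof (induction xs arbitrary: ys)
  case (Cons x xs)
  then have "x \<in> set ys" by (metis list.set_intros(1) mset_eq_setD)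
  then obtain us vs where ys: "ys = us @ x # vs" by (meson split_list)
  have eq: "mset xs = mset (vs @ us)" using Cons.prems ys by simp
  have "jword ys = (jword ((x # vs) @ us) :: ('x, 'k) zin)"
    unfolding ys by (rule jword_append_comm)
  also have "\<dots> = jword ([x] @ (vs @ us))" by simp
  also have "\<dots> = jword ([x] @ xs)"
  \<comment> \<open>An empty tail cannot be split off as a factor: the empty word is 0, not a
    unit.\<close>
  proof (cases "xs = []")
    case False
    then have "vs @ us \<noteq> []" using eq by fastforce
    then have "jword ([x] @ (vs @ us)) = jprod (jword [x]) (jword (vs @ us) :: ('x, 'k) zin)"
      by (intro jword_append) simp_all
    also have "\<dots> = jprod (jword [x]) (jword xs)" using Cons.IH[OF eq] by simp
    also have "\<dots> = jword ([x] @ xs)" using False by (intro jword_append[symmetric]) simp_all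
    finally show ?thesis .
  qed (use eq in simp)
  finally show ?case by simp
qed simp

lemma jword_in_J: "set xs \<subseteq> X \<Longrightarrow> jword xs \<in> J X"
proof (induction xs rule: rev_induct)
  case Nil
  then show ?case by (simp add: J_def sg_zero)
next
  case (snoc y xs)
  have y: "zgen y \<in> J X" using snoc.prems by (auto simp: J_def intro: sg_gen)
  then show ?case
    by (cases "xs = []") (use snoc in \<open>auto simp: jword_snoc J_def intro: sg_prod\<close>)
qed

lemma J_sum: "(\<And>i. i \<in> A \<Longrightarrow> g i \<in> J X) \<Longrightarrow> sum g A \<in> J X"
  by (induction A rule: infinite_finite_induct) (auto simp: J_def intro: sg_zero sg_add)

text \<open>The span is closed under \<open>jprod\<close>, because the product of two nonempty
  Jordan words is the Jordan word of their concatenation.\<close>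

lemma J_subset_span: "J X \<subseteq> zin.span {jword xs | xs. set xs \<subseteq> X}" (is "_ \<subseteq> zin.span ?W")
proof
  fix a :: "('a, 'b) zin"
  assume "a \<in> J X"
  then show "a \<in> zin.span ?W"
    unfolding J_def
  proof (induction rule: subalgebra_generated.induct)
    case (sg_gen s)
    then obtain x where "s = jword [x]" "set [x] \<subseteq> X" by auto
    then have "s \<in> ?W" by blast
    then show ?case by (rule zin.span_base)
  next
    case (sg_prod a b)
    have words: "jprod v w \<in> zin.span ?W" if vw: "v \<in> ?W" "w \<in> ?W" for v w
    proof -
      obtain xs ys where v: "v = jword xs" "set xs \<subseteq> X" and w: "w = jword ys" "set ys \<subseteq> X"
        using vw by auto
      show ?thesis
      proof (cases "xs = [] \<or> ys = []")
        case True
        then show ?thesis using v w by (auto simp: zin.span_zero)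
      next
        case False
        then have "jprod v w = jword (xs @ ys)" using v w by (simp add: jword_append)
        moreover have "set (xs @ ys) \<subseteq> X" using v w by simp
        ultimately have "jprod v w \<in> ?W" by blast
        then show ?thesis by (rule zin.span_base)
      qed
    qed
    have right: "jprod v b \<in> zin.span ?W" if "v \<in> ?W" for v
      using sg_prod.IH(2)
    proof (induction rule: zin.span_induct_alt)
      case base
      show ?case by (simp add: zin.span_zero)
    next
      case (step c w d)
      then show ?case using words[OF that]
        by (simp add: jprod_add jprod_scale zin.span_add zin.span_scale)
    qed
    show ?case using sg_prod.IH(1)
    proof (induction rule: zin.span_induct_alt)
      case base
      show ?case by (simp add: zin.span_zero)
    next
      case (step c w d)
      then show ?case using right
        by (simp add: jprod_add jprod_scale zin.span_add zin.span_scale)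
    qed
  qed (auto simp: zin.span_zero zin.span_add zin.span_scale)
qed

section \<open>From Zinbiel elements to polynomials\<close>

definition expo :: "'x list \<Rightarrow> 'x \<Rightarrow>\<^sub>0 nat" where
  "expo xs = (\<Sum>x\<leftarrow>xs. Poly_Mapping.single x 1)"

lemma expo_simps [simp]:
  "expo [] = 0" "expo (x # xs) = Poly_Mapping.single x 1 + expo xs"
  "expo (xs @ ys) = expo xs + expo ys"
  by (simp_all add: expo_def)

lemma deg_expo [simp]: "deg (expo xs) = length xs"
  by (induction xs) (simp_all add: deg_add)

lemma lookup_expo: "lookup (expo xs) x = count (mset xs) x"
  by (induction xs) (simp_all add: lookup_add lookup_single when_def)

lemma mset_eq_if_expo_eq: "expo xs = expo ys \<Longrightarrow> mset xs = mset ys"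
  by (rule multiset_eqI) (metis lookup_expo)

lemma keys_expo: "Poly_Mapping.keys (expo xs) = set xs"
  by (auto simp: in_keys_iff lookup_expo)

lemma ex_expo: "\<exists>xs. expo xs = m"
proof (induction m rule: poly_mapping_single_induct)
  case zero
  show ?case by (rule exI[of _ "[]"]) simp
next
  case (add m x n)
  then obtain xs where "expo xs = m" by blast
  moreover have "expo (replicate n x) = Poly_Mapping.single x n"
    by (induction n) (simp_all flip: single_add)
  ultimately have "expo (replicate n x @ xs) = Poly_Mapping.single x n + m" by simp
  then show ?case by blast
qed

section \<open>The homomorphism to polynomials\<close>

definition to_poly :: "('x, 'k::field_char_0) zin \<Rightarrow> ('x \<Rightarrow>\<^sub>0 nat) \<Rightarrow>\<^sub>0 'k" where
  "to_poly = (SOME \<phi>. algebra_hom_on UNIV zscale zprod poly_scale poly_zin \<phi> \<and>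
     (\<forall>x. \<phi> (zgen x) = Poly_Mapping.single (Poly_Mapping.single x 1) 1))"

lemma to_poly_hom:
  "algebra_hom_on UNIV zscale zprod poly_scale poly_zin
      (to_poly :: ('x, 'k::field_char_0) zin \<Rightarrow> _) \<and>
    (\<forall>x. to_poly (zgen x :: ('x, 'k) zin) = Poly_Mapping.single (Poly_Mapping.single x 1) 1)"
  unfolding to_poly_def by (rule someI_ex[OF poly.zin_hom_exists])

lemma to_poly_simps [simp]:
  "to_poly (a + b) = to_poly a + to_poly b"
  "to_poly (zscale r a) = poly_scale r (to_poly a)"
  "to_poly (a \<circ>\<^sub>z b) = poly_zin (to_poly a) (to_poly b)"
  "to_poly (zgen x) = Poly_Mapping.single (Poly_Mapping.single x 1) 1"
  using to_poly_hom by (auto simp: algebra_hom_on_def)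

lemma to_poly_zero [simp]: "to_poly 0 = 0"
  by (metis add_cancel_right_left to_poly_simps(1) add_0)

lemma to_poly_sum: "to_poly (sum g A) = (\<Sum>i\<in>A. to_poly (g i))"
  by (induction A rule: infinite_finite_induct) simp_all

text \<open>Appending a letter multiplies by its variable, which d fixes, and then I divides by the
  new degree. These divisions accumulate to n!.\<close>

lemma to_poly_zword:
  assumes "xs \<noteq> []"
  shows "to_poly (zword xs :: ('x, 'k::field_char_0) zin) =
    Poly_Mapping.single (expo xs) (inverse (fact (length xs)))"
  using assms
proof (induction xs rule: rev_induct)
  case (snoc y xs)
  show ?case
  proof (cases "xs = []")
    case False
    \<comment> \<open>Otherwise \<open>drop_const\<close> would erase the left factor.\<close>
    have nz: "expo xs \<noteq> 0"
      using False by (metis deg_expo deg_eq_0_iff length_0_conv)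
    have "poly_zin (Poly_Mapping.single (expo xs) c) (Poly_Mapping.single (Poly_Mapping.single y 1) 1) =
        Poly_Mapping.single (expo xs + Poly_Mapping.single y 1) (inverse (of_nat (Suc (length xs))) * c)"
      for c :: 'k
      using nz by (simp add: poly_zin_def drop_const_def euler_def euler_inv_def mult_single deg_add
          add.commute[of 1] del: One_nat_def)
    then show ?thesis using snoc.IH[OF False] False by (simp add: zword_snoc mult.commute)
  qed simp
qed simp

text \<open>On polynomials without constant term \<open>drop_const\<close> is the identity, so there
  \<open>jprod\<close> becomes ordinary multiplication.\<close>

lemma to_poly_J: "a \<in> J X \<Longrightarrow> to_poly a \<in> polys_without_const X"
  unfolding J_def
proof (induction rule: subalgebra_generated.induct)
  case sg_zero
  show ?case by (simp add: polys_without_const_def)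
next
  case (sg_gen s)
  then obtain x where "s = zgen x" "x \<in> X" by auto
  moreover have "Poly_Mapping.single x (1::nat) \<noteq> 0"
    by (metis deg_single deg_eq_0_iff zero_neq_one)
  ultimately show ?case
    by (auto simp: polys_without_const_def lookup_single when_def)
next
  case (sg_add a b)
  then show ?case
    unfolding polys_without_const_def using Poly_Mapping.keys_add[of "to_poly a" "to_poly b"]
    by (auto simp: lookup_add)
next
  case (sg_scale a r)
  then show ?case
    unfolding polys_without_const_def by (auto simp: in_keys_iff)
next
  case (sg_prod a b)
  have const: "lookup (to_poly a) 0 = 0" "lookup (to_poly b) 0 = 0"
    using sg_prod.IH by (auto simp: polys_without_const_def)
  then have eq: "to_poly (jprod a b) = to_poly a * to_poly b"
    by (simp add: jprod_def poly_zin_symmetrized drop_const_ident)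
  have "drop_const (to_poly a * to_poly b) = to_poly a * to_poly b"
    using drop_const_mult[of "to_poly a" "to_poly b"] const by (simp add: drop_const_ident)
  then have "lookup (to_poly a * to_poly b) 0 = 0"
    using lookup_drop_const_0[of "to_poly a * to_poly b"] by simp
  moreover have "Poly_Mapping.keys m \<subseteq> X"
    if m: "m \<in> Poly_Mapping.keys (to_poly a * to_poly b)" for m
  proof -
    obtain m1 m2 where "m = m1 + m2" "m1 \<in> Poly_Mapping.keys (to_poly a)"
      "m2 \<in> Poly_Mapping.keys (to_poly b)"
      using m keys_mult[of "to_poly a" "to_poly b"] by blast
    then show ?thesis
      using sg_prod.IH Poly_Mapping.keys_add[of m1 m2] unfolding polys_without_const_def by blast
  qed
  ultimately show ?case by (simp add: eq polys_without_const_def)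
qed

lemma to_poly_jprod:
  assumes "a \<in> J X" "b \<in> J X"
  shows "to_poly (jprod a b) = to_poly a * to_poly b"
  using assms[THEN to_poly_J]
  by (simp add: jprod_def poly_zin_symmetrized drop_const_ident polys_without_const_def)

lemma to_poly_jword:
  "xs \<noteq> [] \<Longrightarrow>
    to_poly (jword xs :: ('x, 'k::field_char_0) zin) = Poly_Mapping.single (expo xs) 1"
proof (induction xs rule: rev_induct)
  case (snoc y xs)
  show ?case
  proof (cases "xs = []")
    case False
    have "jword xs \<in> (J UNIV :: ('x, 'k) zin set)" "jword [y] \<in> (J UNIV :: ('x, 'k) zin set)"
      by (rule jword_in_J; simp)+
    then show ?thesis using snoc.IH[OF False] False
      by (simp add: jword_snoc to_poly_jprod[of _ UNIV] mult_single)
  qed simp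
qed simp

section \<open>From polynomials to Jordan elements\<close>

text \<open>By \<open>jword_mset\<close> the choice of the word does not matter. The only word for m
  = 0 is empty, so \<open>jmon 0 = 0\<close>.\<close>

definition jmon :: "('x \<Rightarrow>\<^sub>0 nat) \<Rightarrow> ('x, 'k::field_char_0) zin" where
  "jmon m = jword (SOME xs. expo xs = m)"

lemma jmon_expo: "jmon (expo xs) = jword xs"
  unfolding jmon_def by (rule someI2[of _ xs], simp, rule jword_mset, erule mset_eq_if_expo_eq)

definition of_poly :: "(('x \<Rightarrow>\<^sub>0 nat) \<Rightarrow>\<^sub>0 'k::field_char_0) \<Rightarrow> ('x, 'k) zin" where
  "of_poly p = (\<Sum>m\<in>Poly_Mapping.keys p. zscale (lookup p m) (jmon m))"

lemma of_poly_zero [simp]: "of_poly 0 = 0"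
  by (simp add: of_poly_def)

lemma of_poly_add: "of_poly (p + q) = of_poly p + of_poly q"
  unfolding of_poly_def
  by (rule setsum_keys_plus_distrib) (simp_all add: zin.scale_left_distrib)

lemma of_poly_single: "of_poly (Poly_Mapping.single m c) = zscale c (jmon m)"
  by (simp add: of_poly_def)

lemma of_poly_scale: "of_poly (poly_scale r p) = zscale r (of_poly p)"
proof (induction p rule: poly_mapping_single_induct)
  case zero
  show ?case by simp
next
  case (add p m c)
  then show ?case
    by (simp add: poly_scale_add of_poly_add of_poly_single zin.scale_right_distrib)
qed

text \<open>Under \<open>to_poly\<close> the two kinds of words give the same monomial, with
  coefficients 1/n! and 1. For the empty word both sides are 0.\<close>

lemma of_poly_to_poly_zword:
  "of_poly (to_poly (zword xs)) = zscale (inverse (fact (length xs))) (jword xs)"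
  by (cases "xs = []") (simp_all add: to_poly_zword of_poly_single jmon_expo)

lemma of_poly_to_poly_J: "a \<in> J X \<Longrightarrow> of_poly (to_poly a) = a"
proof -
  assume "a \<in> J X"
  then have "a \<in> zin.span {jword xs | xs. set xs \<subseteq> X}" using J_subset_span by blast
  then show ?thesis
  proof (induction rule: zin.span_induct_alt)
    case base
    show ?case by simp
  next
    case (step c w b)
    then obtain xs where "w = jword xs" by auto
    then have "of_poly (to_poly w) = w"
      by (cases "xs = []") (simp_all add: to_poly_jword of_poly_single jmon_expo)
    with step show ?case by (simp add: of_poly_add of_poly_scale)
  qed
qed

lemma of_poly_in_J:
  assumes "p \<in> polys_without_const X"
  shows "of_poly p \<in> J X"
  unfolding of_poly_def
proof (rule J_sum)
  fix m assume "m \<in> Poly_Mapping.keys p"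
  then have "Poly_Mapping.keys m \<subseteq> X" using assms by (auto simp: polys_without_const_def)
  moreover obtain xs where "m = expo xs" using ex_expo by metis
  ultimately have "jmon m \<in> J X" by (simp add: jmon_expo keys_expo jword_in_J)
  then show "zscale (lookup p m) (jmon m) \<in> J X" unfolding J_def by (rule sg_scale)
qed

lemma to_poly_of_poly:
  assumes "p \<in> polys_without_const X"
  shows "to_poly (of_poly p) = p"
proof -
  have "to_poly (of_poly p) =
      (\<Sum>m\<in>Poly_Mapping.keys p. poly_scale (lookup p m) (to_poly (jmon m)))"
    by (simp add: of_poly_def to_poly_sum)
  also have "\<dots> = (\<Sum>m\<in>Poly_Mapping.keys p. Poly_Mapping.single m (lookup p m))"
  proof (rule sum.cong)
    fix m assume m: "m \<in> Poly_Mapping.keys p"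
    obtain xs where xs: "m = expo xs" using ex_expo by metis
    \<comment> \<open>A constant term would be lost, because \<open>jmon 0 = 0\<close>.\<close>
    have "m \<noteq> 0" using m assms by (auto simp: polys_without_const_def in_keys_iff)
    then have "xs \<noteq> []" using xs by auto
    then show "poly_scale (lookup p m) (to_poly (jmon m)) = Poly_Mapping.single m (lookup p m)"
      by (simp add: xs jmon_expo to_poly_jword)
  qed simp
  finally show ?thesis by (simp flip: poly_mapping_sum_single)
qed

section \<open>The isomorphism with polynomials\<close>

lemma J_iso_polys:
  "algebras_isomorphic (J X :: ('x, 'k::field_char_0) zin set) zscale jprod
     (polys_without_const X) poly_scale (*)"
  unfolding algebras_isomorphic_def
proof (intro exI conjI)
  show "bij_betw to_poly (J X :: ('x, 'k) zin set) (polys_without_const X)"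
    by (rule bij_betw_byWitness[where f' = of_poly])
      (blast intro: of_poly_to_poly_J to_poly_of_poly to_poly_J of_poly_in_J)+
  show "algebra_hom_on (J X :: ('x, 'k) zin set) zscale jprod poly_scale (*) to_poly"
    by (simp add: algebra_hom_on_def to_poly_jprod[of _ X])
qed

section \<open>The Dynkin map\<close>

lemma dynkin_linear: "Vector_Spaces.linear zscale zscale dynkin"
  and dynkin_zword: "dynkin (zword xs) = jword xs"
  using theI'[OF dynkin_ex1] unfolding dynkin_def by auto

text \<open>All words in f have the same length n, so a single factor n! serves for the whole linear
  combination.\<close>

lemma dynkin_homogeneous:
  fixes f :: "('x, 'k::field_char_0) zin"
  assumes "f \<in> homogeneous X n"
  shows "dynkin f = zscale (fact n) (of_poly (to_poly f))"
proof -
  interpret D: Vector_Spaces.linear zscale zscale "dynkin :: ('x, 'k) zin \<Rightarrow> _"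
    by (rule dynkin_linear)
  show ?thesis
    using assms unfolding homogeneous_def
  proof (induction rule: zin.span_induct_alt)
    case base
    show ?case by (simp add: D.zero)
  next
    case (step c w b)
    then obtain xs where "w = zword xs" "length xs = n" by auto
    then have "dynkin w = zscale (fact n) (of_poly (to_poly w))"
      by (simp add: dynkin_zword of_poly_to_poly_zword)
    with step show ?case
      by (simp add: D.add D.scale of_poly_add of_poly_scale zin.scale_right_distrib mult.commute)
  qed
qed

text \<open>Each word is sent to a Jordan word. This yields the direction from the Dynkin equation
  to membership in \<open>J X\<close>.\<close>

lemma dynkin_homogeneous_in_J:
  fixes f :: "('x, 'k::field) zin"
  assumes "f \<in> homogeneous X n"
  shows "dynkin f \<in> J X"
proof -
  interpret D: Vector_Spaces.linear zscale zscale "dynkin :: ('x, 'k) zin \<Rightarrow> _"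
    by (rule dynkin_linear)
  show ?thesis
    using assms unfolding homogeneous_def
  proof (induction rule: zin.span_induct_alt)
    case base
    show ?case by (simp add: D.zero J_def sg_zero)
  next
    case (step c w b)
    then have "dynkin w \<in> J X" by (auto simp: dynkin_zword jword_in_J)
    with step show ?case unfolding D.add D.scale J_def by (intro sg_add sg_scale)
  qed
qed

theorem theorem2p4:
  fixes X :: "'x set"
  shows "(\<forall>n. \<forall>f \<in> (homogeneous X n :: ('x, 'k::field_char_0) zin set).
            f \<in> J X \<longleftrightarrow> dynkin f = zscale (fact n) f)
       \<and> algebras_isomorphic
            (J X :: ('x, 'k) zin set) zscale jprod
            (polys_without_const X :: (('x \<Rightarrow>\<^sub>0 nat) \<Rightarrow>\<^sub>0 'k) set) poly_scale (*)"
proof (intro conjI allI ballI iffI)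
  fix n and f :: "('x, 'k) zin"
  assume hom: "f \<in> homogeneous X n"
  show "dynkin f = zscale (fact n) f" if "f \<in> J X"
    using dynkin_homogeneous[OF hom] of_poly_to_poly_J[OF that] by simp
  assume "dynkin f = zscale (fact n) f"
  \<comment> \<open>In characteristic 0 the scalar n! is invertible.\<close>
  then have "f = zscale (inverse (fact n)) (dynkin f)" by simp
  also have "\<dots> \<in> J X"
    using dynkin_homogeneous_in_J[OF hom] unfolding J_def by (rule sg_scale)
  finally show "f \<in> J X" .
qed (rule J_iso_polys)

end
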